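(* Let $(G,p)$ be an $r$-dimensional tensegrity framework on $n$ vertices in $\mathbb{R}^r$, let $\bar r=n-r-1$, and let $Z$ be a Gale matrix of $(G,p)$. Then there exists a tensegrity framework $(G,p')$ affinely-dominated by, but not congruent to, $(G,p)$ if and only if there exist a non-zero $y=(y_{ij})\in\mathbb{R}^{|\overline{E}|+|C|+|S|}$ and $\xi=(\xi_i)\in\mathbb{R}^{\bar r}$, where $y_{ij}\ge 0$ for all $\{i,j\}\in C$ and $y_{ij}\le 0$ for all $\{i,j\}\in S$, such that $$\mathcal{E}(y)Z=e\xi^T.$$
   Context: A tensegrity graph $G=(V,E)$ is a simple connected graph with $V=\{1,\ldots,n\}$ in which each edge is labelled as either a bar, a cable or a strut; $B$, $C$, $S$ denote the sets of bars, cables and struts, so $E=B\cup C\cup S$ (disjoint union). $\overline{E}$ denotes the set of missing edges, $\overline{E}=\{\{i,j\}: i\ne j,\ \{i,j\}\notin E\}$. A tensegrity framework $(G,p)$ in $\mathbb{R}^r$ is a tensegrity graph $G$ together with a configuration $p=(p^1,\ldots,p^n)$ of points $p^i\in\mathbb{R}^r$. It is $r$-dimensional if $r$ is the dimension of the affine span of $p^1,\ldots,p^n$. Its configuration matrix $P$ is the $n\times r$ matrix whose $i$th row is $(p^i)^T$. $e$ is the all-ones vector in $\mathbb{R}^n$. A Gale matrix of an $r$-dimensional $(G,p)$ in $\mathbb{R}^r$ is any $n\times\bar r$ matrix $Z$ whose columns form a basis of the null space of $\begin{bmatrix}P^T\\ e^T\end{bmatrix}$. $(G,q)$ is congruent to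 $(G,p)$ if $\|q^i-q^j\|^2=\|p^i-p^j\|^2$ for all $i,j=1,\ldots,n$. $(G,q)$ is dominated by $(G,p)$ if $\|q^i-q^j\|^2=\|p^i-p^j\|^2$ for each $\{i,j\}\in B$, $\|q^i-q^j\|^2\le\|p^i-p^j\|^2$ for each $\{i,j\}\in C$, and $\|q^i-q^j\|^2\ge\|p^i-p^j\|^2$ for each $\{i,j\}\in S$. $(G,q)$ is affinely-dominated by $(G,p)$ if it is dominated by $(G,p)$ and there are an $r\times r$ matrix $A$ and $b\in\mathbb{R}^r$ with $q^i=Ap^i+b$ for all $i=1,\ldots,n$. $e^i$ is the $i$th standard unit vector in $\mathbb{R}^n$, $E^{ij}=e^i(e^j)^T+e^j(e^i)^T$, and for $y=(y_{ij})$ indexed by $\overline{E}\cup C\cup S$, $\mathcal{E}(y)=\sum_{\{i,j\}\in\overline{E}\cup C\cup S}y_{ij}E^{ij}$. *)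

theory Defs
  imports
    "Jordan_Normal_Form.Matrix_Kernel"
begin

text \<open>
  Vectors and matrices are those of \<open>Jordan_Normal_Form\<close>, whose dimensions are natural numbers:
  a Gale matrix has \<open>n - r - 1\<close> columns, which may be \<open>0\<close>. Indices start at \<open>0\<close> there, so
  the vertex set is \<open>{0..<n}\<close> instead of \<open>{1..n}\<close>. An edge is a two-element set of vertices.
\<close>

record tensegrity_graph =
  nverts :: nat
  bars :: "nat set set"
  cables :: "nat set set"
  struts :: "nat set set"

definition all_pairs :: "nat \<Rightarrow> nat set set" where
  "all_pairs n = {{i, j} | i j. i < n \<and> j < n \<and> i \<noteq> j}"

definition edges :: "tensegrity_graph \<Rightarrow> nat set set" where
  "edges G = bars G \<union> cables G \<union> struts G"

definition missing_edges :: "tensegrity_graph \<Rightarrow> nat set set" where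
  "missing_edges G = all_pairs (nverts G) - edges G"

definition graph_connected :: "nat \<Rightarrow> nat set set \<Rightarrow> bool" where
  "graph_connected n E \<longleftrightarrow>
     n > 0 \<and> (\<forall>u<n. \<forall>v<n. (u, v) \<in> {(i, j). {i, j} \<in> E}\<^sup>*)"

definition is_tensegrity_graph :: "tensegrity_graph \<Rightarrow> bool" where
  "is_tensegrity_graph G \<longleftrightarrow>
     edges G \<subseteq> all_pairs (nverts G) \<and>
     bars G \<inter> cables G = {} \<and> bars G \<inter> struts G = {} \<and> cables G \<inter> struts G = {} \<and>
     graph_connected (nverts G) (edges G)"

text \<open>Only the values \<open>p i\<close> with \<open>i < nverts G\<close> are relevant.\<close>

definition tensegrity_framework :: "nat \<Rightarrow> tensegrity_graph \<Rightarrow> (nat \<Rightarrow> real vec) \<Rightarrow> bool" where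
  "tensegrity_framework r G p \<longleftrightarrow>
     is_tensegrity_graph G \<and> (\<forall>i < nverts G. p i \<in> carrier_vec r)"

definition affine_span :: "nat \<Rightarrow> nat \<Rightarrow> (nat \<Rightarrow> real vec) \<Rightarrow> real vec set" where
  "affine_span r n p =
     {vec r (\<lambda>k. \<Sum>i<n. c i * p i $ k) | c :: nat \<Rightarrow> real. (\<Sum>i<n. c i) = 1}"

text \<open>The dimension of a nonempty affine subspace of \<open>\<real>\<^sup>r\<close> is that of its direction space.\<close>

definition affine_subspace_dim :: "nat \<Rightarrow> real vec set \<Rightarrow> nat" where
  "affine_subspace_dim r X =
     vectorspace.dim class_ring
       (module_vec TYPE(real) r \<lparr>carrier := {x - y | x y. x \<in> X \<and> y \<in> X}\<rparr>)"

definition framework_dim :: "nat \<Rightarrow> tensegrity_graph \<Rightarrow> (nat \<Rightarrow> real vec) \<Rightarrow> nat" where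
  "framework_dim r G p = affine_subspace_dim r (affine_span r (nverts G) p)"

definition sq_dist :: "real vec \<Rightarrow> real vec \<Rightarrow> real" where
  "sq_dist x y = scalar_prod (x - y) (x - y)"

definition fw_congruent :: "tensegrity_graph \<Rightarrow> (nat \<Rightarrow> real vec) \<Rightarrow> (nat \<Rightarrow> real vec) \<Rightarrow> bool" where
  "fw_congruent G q p \<longleftrightarrow>
     (\<forall>i < nverts G. \<forall>j < nverts G. sq_dist (q i) (q j) = sq_dist (p i) (p j))"

text \<open>In the next two definitions \<open>q\<close> is the framework dominated by \<open>p\<close>.\<close>

definition dominated :: "tensegrity_graph \<Rightarrow> (nat \<Rightarrow> real vec) \<Rightarrow> (nat \<Rightarrow> real vec) \<Rightarrow> bool" where
  "dominated G q p \<longleftrightarrow>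
     (\<forall>i j. {i, j} \<in> bars G \<longrightarrow> sq_dist (q i) (q j) = sq_dist (p i) (p j)) \<and>
     (\<forall>i j. {i, j} \<in> cables G \<longrightarrow> sq_dist (q i) (q j) \<le> sq_dist (p i) (p j)) \<and>
     (\<forall>i j. {i, j} \<in> struts G \<longrightarrow> sq_dist (q i) (q j) \<ge> sq_dist (p i) (p j))"

definition affinely_dominated ::
    "nat \<Rightarrow> tensegrity_graph \<Rightarrow> (nat \<Rightarrow> real vec) \<Rightarrow> (nat \<Rightarrow> real vec) \<Rightarrow> bool" where
  "affinely_dominated r G q p \<longleftrightarrow>
     dominated G q p \<and>
     (\<exists>A \<in> carrier_mat r r. \<exists>b \<in> carrier_vec r. \<forall>i < nverts G. q i = A *\<^sub>v p i + b)"

definition ones_vec :: "nat \<Rightarrow> real vec" where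
  "ones_vec n = vec n (\<lambda>_. 1)"

definition outer_prod :: "real vec \<Rightarrow> real vec \<Rightarrow> real mat" where
  "outer_prod u v = mat (dim_vec u) (dim_vec v) (\<lambda>(i, j). u $ i * v $ j)"

definition config_mat :: "nat \<Rightarrow> nat \<Rightarrow> (nat \<Rightarrow> real vec) \<Rightarrow> real mat" where
  "config_mat r n p = mat_of_rows r (map p [0..<n])"

text \<open>\<open>basis\<close> takes a set of vectors, so \<open>distinct\<close> is needed to exclude repeated columns.\<close>

definition gale_matrix :: "nat \<Rightarrow> tensegrity_graph \<Rightarrow> (nat \<Rightarrow> real vec) \<Rightarrow> real mat \<Rightarrow> bool" where
  "gale_matrix r G p Z \<longleftrightarrow>
     (let n = nverts G;
          M = transpose_mat (config_mat r n p) @\<^sub>r mat_of_rows n [ones_vec n]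
      in Z \<in> carrier_mat n (n - r - 1) \<and> distinct (cols Z) \<and>
         vectorspace.basis class_ring
           (module_vec TYPE(real) n \<lparr>carrier := mat_kernel M\<rparr>) (set (cols Z)))"

definition sym_unit_mat :: "nat \<Rightarrow> nat \<Rightarrow> nat \<Rightarrow> real mat" where
  "sym_unit_mat n i j =
     outer_prod (unit_vec n i) (unit_vec n j) + outer_prod (unit_vec n j) (unit_vec n i)"

definition edge_index :: "tensegrity_graph \<Rightarrow> nat set set" where
  "edge_index G = missing_edges G \<union> cables G \<union> struts G"

text \<open>
  The entrywise sum of the matrices \<open>y\<^sub>i\<^sub>j E\<^sup>i\<^sup>j\<close>, one summand for each unordered
  pair; \<open>E\<^sup>i\<^sup>j = E\<^sup>j\<^sup>i\<close>, so the choice of \<open>i\<close> as the smaller end is immaterial.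
  Only the values of \<open>y\<close> on \<open>edge_index G\<close> are relevant.
\<close>

definition edge_mat :: "tensegrity_graph \<Rightarrow> (nat set \<Rightarrow> real) \<Rightarrow> real mat" where
  "edge_mat G y = mat (nverts G) (nverts G)
     (\<lambda>(k, l). \<Sum>d \<in> edge_index G. y d * sym_unit_mat (nverts G) (Min d) (Max d) $$ (k, l))"

end

theory Submission
  imports Defs
begin

text \<open>
  For an affine image \<open>q\<^sup>i = A p\<^sup>i + b\<close> the matrix \<open>Y\<close> of differences
  \<open>\<parallel>p\<^sup>i - p\<^sup>j\<parallel>\<^sup>2 - \<parallel>q\<^sup>i - q\<^sup>j\<parallel>\<^sup>2\<close> is of the form \<open>\<E>(y)\<close>, and every
  affine dependency of the \<open>p\<^sup>i\<close>, in particular every column of \<open>Z\<close>, is sent by \<open>Y\<close> to a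
  multiple of \<open>e\<close>, because the mixed terms of the squared distances cancel.

  Conversely, let \<open>Y = \<E>(y)\<close> with \<open>Y Z = e \<xi>\<^sup>T\<close>. The coefficients \<open>\<beta>\<^sub>k\<close> (of sum \<open>0\<close>) of
  the unit vectors over the \<open>p\<^sup>i\<close> give the affine dependencies
  \<open>e\<^sup>j - e\<^sup>0 - \<Sum>\<^sub>k (p\<^sup>j - p\<^sup>0)\<^sub>k \<beta>\<^sub>k\<close>. Applying the rows of
  \<open>H\<^sub>i\<^sub>j = Y\<^sub>i\<^sub>j - Y\<^sub>0\<^sub>j - Y\<^sub>i\<^sub>0\<close> to them, once for each index, shows that \<open>H\<close> is a symmetric
  bilinear form \<open>T\<close> in \<open>p\<^sup>i - p\<^sup>0\<close> and \<open>p\<^sup>j - p\<^sup>0\<close>; since \<open>Y\<close> has zero diagonal,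
  \<open>Y\<^sub>i\<^sub>j = -(p\<^sup>i - p\<^sup>j)\<^sup>T T (p\<^sup>i - p\<^sup>j) / 2\<close>. For small \<open>\<epsilon> > 0\<close> the matrix \<open>I + \<epsilon> T\<close>
  has a Cholesky factorization \<open>A\<^sup>T A\<close>, and \<open>q\<^sup>i = A p\<^sup>i\<close> is the required framework.
\<close>

section \<open>Factorization near the identity, full subspaces, and the quadratic form behind a
  stress\<close>

text \<open>
  The radius depends on \<open>n\<close> because passing to the Schur complement of the last
  entry at most triples the distance from the identity.
\<close>

lemma gram_near_identity:
  fixes M :: "nat \<Rightarrow> nat \<Rightarrow> real"
  assumes "\<And>i j. i < n \<Longrightarrow> j < n \<Longrightarrow> M i j = M j i"
    and "\<And>i j. i < n \<Longrightarrow> j < n \<Longrightarrow> \<bar>M i j - (if i = j then 1 else 0)\<bar> \<le> 1 / (2 * 3 ^ n)"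
  shows "\<exists>A. \<forall>i<n. \<forall>j<n. M i j = (\<Sum>k<n. A k i * A k j)"
  using assms
proof (induction n arbitrary: M)
  case 0
  then show ?case by simp
next
  case (Suc n)
  define \<delta> :: real where "\<delta> = 1 / (2 * 3 ^ Suc n)"
  define m where "m = M n n"
  define N where "N i j = M i j - M i n * M n j / m" for i j
  have \<delta>: "\<delta> > 0" "\<delta> \<le> 1/2" "3 * \<delta> = 1 / (2 * 3 ^ n)"
    using one_le_power[of "3::real" "Suc n"] unfolding \<delta>_def by (auto simp: field_simps)
  have m: "m \<ge> 1/2"
    using Suc.prems(2)[of n n] \<delta> unfolding m_def \<delta>_def[symmetric] by auto
  have off: "\<bar>M i n\<bar> \<le> \<delta>" "\<bar>M n i\<bar> \<le> \<delta>" if "i < n" for i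
    using Suc.prems(2)[of i n] Suc.prems(2)[of n i] that by (auto simp: \<delta>_def)
  have "\<exists>A. \<forall>i<n. \<forall>j<n. N i j = (\<Sum>k<n. A k i * A k j)"
  proof (rule Suc.IH)
    fix i j assume ij: "i < n" "j < n"
    show "N i j = N j i"
      using Suc.prems(1)[of i j] Suc.prems(1)[of i n] Suc.prems(1)[of j n] ij by (simp add: N_def)
    \<comment> \<open>Since \<open>\<delta> \<le> 1/2 \<le> m\<close>, the correction is at most
      \<open>\<delta>\<close>; the weaker bound \<open>2 * \<delta>\<close> suffices, as the total
      \<open>3 * \<delta>\<close> is the radius for \<open>n\<close>.\<close>
    have "\<bar>M i n * M n j\<bar> \<le> \<delta> * \<delta>"
      unfolding abs_mult using off[OF ij(1)] off[OF ij(2)] by (intro mult_mono) auto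
    also have "\<dots> \<le> \<delta> * (1 / 2)" using \<delta> by (intro mult_left_mono) auto
    also have "\<dots> \<le> \<delta> * m" using \<delta> m by (intro mult_left_mono) auto
    also have "\<dots> \<le> 2 * \<delta> * m" using \<delta> m by simp
    finally have "\<bar>M i n * M n j / m\<bar> \<le> 2 * \<delta>"
      using m by (simp add: abs_mult abs_divide divide_le_eq)
    moreover have "\<bar>M i j - (if i = j then 1 else 0)\<bar> \<le> \<delta>"
      using Suc.prems(2)[of i j] ij by (simp add: \<delta>_def)
    ultimately show "\<bar>N i j - (if i = j then 1 else 0)\<bar> \<le> 1 / (2 * 3 ^ n)"
      unfolding N_def \<delta>(3)[symmetric] by linarith
  qed
  then obtain A where A: "\<And>i j. i < n \<Longrightarrow> j < n \<Longrightarrow> N i j = (\<Sum>k<n. A k i * A k j)"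
    by blast
  \<comment> \<open>Row \<open>n\<close> alone carries the last row and column of \<open>M\<close>.
    The zeros in column \<open>n\<close> of the other rows keep out the values \<open>A k n\<close>,
    about which nothing is known.\<close>
  define B where "B k i = (if k < n then (if i < n then A k i else 0) else M i n / sqrt m)" for k i
  have sm: "sqrt m * sqrt m = m" using m by simp
  have "M i j = (\<Sum>k<Suc n. B k i * B k j)" if ij: "i < Suc n" "j < Suc n" for i j
  proof -
    have "B n i * B n j = M i n * M j n / (sqrt m * sqrt m)"
      by (simp add: B_def)
    then have last: "B n i * B n j = M i n * M j n / m"
      by (simp only: sm)
    show ?thesis
    proof (cases "i < n \<and> j < n")
      case True
      then have "(\<Sum>k<n. B k i * B k j) = N i j"
        by (simp add: A B_def)
      then show ?thesis
        using last Suc.prems(1)[of j n] ij by (simp add: N_def)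
    next
      case False
      then have "(\<Sum>k<n. B k i * B k j) = 0"
        by (intro sum.neutral) (auto simp: B_def)
      moreover have "M i n * M j n / m = M i j"
        using False ij m Suc.prems(1)[of j n] unfolding m_def by (auto simp: less_Suc_eq)
      ultimately show ?thesis using last by simp
    qed
  qed
  then show ?case by blast
qed

text \<open>Independent subsets of \<open>W\<close> are independent in \<open>V\<close>, so their
  size is bounded by \<open>dim\<close> and a maximal one is a finite basis of \<open>W\<close>.
  Having \<open>dim\<close> elements, it is a basis of \<open>V\<close> as well, and its span stays
  inside \<open>W\<close>.\<close>

lemma (in vectorspace) subspace_full_dim:
  assumes fd: "fin_dim" and W: "subspace K W V" and dimW: "vectorspace.dim K (vs W) = dim"
  shows "W = carrier V"
proof -
  interpret W: vectorspace K "vs W" using subspace_is_vs[OF W] .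
  have sm: "submodule K W V" using W by (simp add: subspace_def)
  have WV: "W \<subseteq> carrier V" using sm by (simp add: submodule_def)
  have indep: "W.lin_indpt S \<longleftrightarrow> lin_indpt S" if "S \<subseteq> W" for S
    using span_li_not_depend(2)[OF that sm] by simp
  have "\<exists>A. finite A \<and> maximal A (\<lambda>S. S \<subseteq> carrier (vs W) \<and> W.lin_indpt S)"
  proof (rule maximal_exists)
    show "finite S \<and> card S \<le> dim" if "S \<subseteq> carrier (vs W) \<and> W.lin_indpt S" for S
      using li_le_dim[OF fd, of S] that indep WV by auto
    show "{} \<subseteq> carrier (vs W) \<and> W.lin_indpt {}"
      by (auto simp: W.lin_dep_def)
  qed
  then obtain A where finA: "finite A" and A: "W.basis A"
    using W.max_li_is_basis by blast
  have AW: "A \<subseteq> W" and "lin_indpt A"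
    using A indep unfolding W.basis_def by auto
  moreover have "card A = dim"
    using W.dim_basis[OF finA A] dimW by simp
  ultimately have "basis A"
    using dim_li_is_basis[OF fd finA] WV by auto
  then show ?thesis
    using span_is_subset[OF AW sm] WV unfolding basis_def by auto
qed

text \<open>The hypothesis \<open>const\<close> is the stress equation freed from \<open>Z\<close>:
  all rows of \<open>Y\<close> agree on every affine dependency. The weights
  \<open>\<beta> k\<close> write the unit vectors as differences within the affine span.\<close>

lemma zero_diagonal_matrix_quadratic_form:
  fixes Y p \<beta> :: "nat \<Rightarrow> nat \<Rightarrow> real"
  assumes "n > 0"
    and sym: "\<And>i j. i < n \<Longrightarrow> j < n \<Longrightarrow> Y i j = Y j i"
    and diag: "\<And>i. i < n \<Longrightarrow> Y i i = 0"
    and \<beta>_sum: "\<And>k. k < r \<Longrightarrow> (\<Sum>m<n. \<beta> k m) = 0"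
    and \<beta>_dual: "\<And>k l. k < r \<Longrightarrow> l < r \<Longrightarrow> (\<Sum>m<n. \<beta> k m * p m l) = (if k = l then 1 else 0)"
    and const: "\<And>z. (\<Sum>m<n. z m) = 0 \<Longrightarrow> (\<And>l. l < r \<Longrightarrow> (\<Sum>m<n. z m * p m l) = 0)
      \<Longrightarrow> \<exists>c. \<forall>i<n. (\<Sum>m<n. Y i m * z m) = c"
  shows "\<exists>T :: nat \<Rightarrow> nat \<Rightarrow> real. (\<forall>k l. T k l = T l k) \<and>
    (\<forall>i<n. \<forall>j<n.
      Y i j = - (1 / 2) * (\<Sum>k<r. \<Sum>l<r. T k l * (p i k - p j k) * (p i l - p j l)))"
proof -
  \<comment> \<open>Polarization with vertex 0 as origin: if \<open>Y i j\<close> is -1/2 times a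
    quadratic form at \<open>v i - v j\<close>, then \<open>H i j\<close> is the associated bilinear
    form at \<open>v i\<close> and \<open>v j\<close>.\<close>
  define H where "H i j = Y i j - Y 0 j - Y i 0" for i j
  define v where "v i k = p i k - p 0 k" for i k
  have H_sym: "H i j = H j i" if "i < n" "j < n" for i j
    using that sym[of i j] sym[of 0 i] sym[of 0 j] by (simp add: H_def)
  have expand: "H i j = (\<Sum>k<r. v j k * (\<Sum>m<n. \<beta> k m * H m i))" if ij: "i < n" "j < n" for i j
  proof -
    define z where "z m = (if m = j then 1 else 0) - (if m = 0 then 1 else 0)
      - (\<Sum>k<r. v j k * \<beta> k m)" for m
    \<comment> \<open>The pairing with a general \<open>g\<close> serves three times: for the
      constant 1, for the coordinates of the points, and for the row \<open>H i\<close>.\<close>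
    have z_mult: "(\<Sum>m<n. z m * g m) = g j - g 0 - (\<Sum>k<r. v j k * (\<Sum>m<n. \<beta> k m * g m))"
      for g :: "nat \<Rightarrow> real"
    proof -
      have "(\<Sum>m<n. z m * g m) = (\<Sum>m<n. (if m = j then g m else 0) - (if m = 0 then g m else 0)
          - (\<Sum>k<r. v j k * (\<beta> k m * g m)))"
        by (intro sum.cong refl) (simp add: z_def left_diff_distrib sum_distrib_right mult.assoc)
      also have "\<dots> = g j - g 0 - (\<Sum>m<n. \<Sum>k<r. v j k * (\<beta> k m * g m))"
        using ij \<open>n > 0\<close> by (simp add: sum_subtractf)
      also have "(\<Sum>m<n. \<Sum>k<r. v j k * (\<beta> k m * g m)) = (\<Sum>k<r. v j k * (\<Sum>m<n. \<beta> k m * g m))"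
        by (subst sum.swap) (simp add: sum_distrib_left)
      finally show ?thesis .
    qed
    have z_sum: "(\<Sum>m<n. z m) = 0"
      using z_mult[of "\<lambda>_. 1"] \<beta>_sum by simp
    have "(\<Sum>m<n. z m * p m l) = 0" if "l < r" for l
    proof -
      have "(\<Sum>k<r. v j k * (\<Sum>m<n. \<beta> k m * p m l)) = (\<Sum>k<r. if k = l then v j k else 0)"
        using \<beta>_dual that by (intro sum.cong) auto
      then show ?thesis
        using z_mult[of "\<lambda>m. p m l"] that by (simp add: v_def)
    qed
    from const[OF z_sum this] obtain c where c: "\<forall>i<n. (\<Sum>m<n. Y i m * z m) = c"
      by blast
    \<comment> \<open>Subtracting row 0 cancels the common value \<open>c\<close>; the term
      \<open>Y i 0\<close>, constant in \<open>m\<close>, vanishes because \<open>z\<close> sums to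
      0.\<close>
    have "(\<Sum>m<n. z m * H i m) = (\<Sum>m<n. Y i m * z m) - (\<Sum>m<n. Y 0 m * z m) - (\<Sum>m<n. z m) * Y i 0"
      unfolding H_def sum_distrib_right sum_subtractf[symmetric]
      by (intro sum.cong refl) (simp add: algebra_simps)
    also have "\<dots> = 0"
      using c ij \<open>n > 0\<close> z_sum by simp
    finally have "H i j = H i 0 + (\<Sum>k<r. v j k * (\<Sum>m<n. \<beta> k m * H i m))"
      using z_mult[of "H i"] by simp
    moreover have "H i 0 = 0"
      using diag \<open>n > 0\<close> by (simp add: H_def)
    moreover have "(\<Sum>m<n. \<beta> k m * H i m) = (\<Sum>m<n. \<beta> k m * H m i)" for k
      using H_sym ij by (intro sum.cong) auto
    ultimately show ?thesis by simp
  qed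
  define T where "T k l = (\<Sum>m<n. \<Sum>s<n. \<beta> k m * \<beta> l s * H s m)" for k l
  have T_sym: "T k l = T l k" for k l
    unfolding T_def by (subst sum.swap) (use H_sym in \<open>auto intro!: sum.cong\<close>)
  have H_T: "H i j = (\<Sum>k<r. \<Sum>l<r. T k l * v j k * v i l)" if ij: "i < n" "j < n" for i j
  proof -
    \<comment> \<open>One use of \<open>expand\<close> replaces \<open>j\<close> by the frame and
      leaves \<open>i\<close> in second place, where a further use replaces it too.\<close>
    have "(\<Sum>m<n. \<beta> k m * H m i) = (\<Sum>l<r. T k l * v i l)" for k
    proof -
      have "(\<Sum>m<n. \<beta> k m * H m i)
          = (\<Sum>m<n. \<beta> k m * (\<Sum>l<r. v i l * (\<Sum>s<n. \<beta> l s * H s m)))"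
        using ij by (intro sum.cong refl arg_cong2[where f = "(*)"] expand) auto
      also have "\<dots> = (\<Sum>m<n. \<Sum>l<r. v i l * (\<Sum>s<n. \<beta> k m * \<beta> l s * H s m))"
        by (simp add: sum_distrib_left algebra_simps)
      also have "\<dots> = (\<Sum>l<r. T k l * v i l)"
        unfolding T_def by (subst sum.swap) (simp add: sum_distrib_left mult.commute)
      finally show ?thesis .
    qed
    then show ?thesis
      using expand[OF ij] by (simp add: sum_distrib_left algebra_simps)
  qed
  have "Y i j = - (1 / 2) * (\<Sum>k<r. \<Sum>l<r. T k l * (p i k - p j k) * (p i l - p j l))"
    if ij: "i < n" "j < n" for i j
  proof -
    have "(\<Sum>k<r. \<Sum>l<r. T k l * (p i k - p j k) * (p i l - p j l)) =
        (\<Sum>k<r. \<Sum>l<r. T k l * v i k * v i l - T k l * v j k * v i l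
          - T k l * v i k * v j l + T k l * v j k * v j l)"
      by (intro sum.cong refl) (simp add: v_def algebra_simps)
    also have "\<dots> = H i i - H i j - H j i + H j j"
      using ij by (simp add: H_T sum.distrib sum_subtractf)
    \<comment> \<open>With zero diagonal, \<open>H i i\<close> is \<open>-2 * Y i 0\<close>, so all
      entries involving vertex 0 cancel.\<close>
    also have "\<dots> = - 2 * Y i j"
      using ij \<open>n > 0\<close> sym[of i j] sym[of i 0] sym[of j 0] by (simp add: H_def diag)
    finally show ?thesis by simp
  qed
  with T_sym show ?thesis by blast
qed

section \<open>Entries of E(y), affine dependencies and Gale matrices\<close>

text \<open>An indexed pair has distinct ends, so its matrix has entry 1 at its two positions and 0
  elsewhere. Hence at most one summand reaches a given entry, and none reaches the diagonal.\<close>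

lemma edge_mat_index:
  assumes "is_tensegrity_graph G" and ij: "i < nverts G" "j < nverts G"
  shows "edge_mat G y $$ (i, j) = (if {i, j} \<in> edge_index G then y {i, j} else 0)"
proof -
  let ?n = "nverts G"
  have sub: "edge_index G \<subseteq> all_pairs ?n"
    using assms(1) unfolding is_tensegrity_graph_def edge_index_def missing_edges_def edges_def by auto
  have "all_pairs ?n \<subseteq> Pow {..<?n}"
    unfolding all_pairs_def by auto
  with sub have fin: "finite (edge_index G)"
    by (meson finite_Pow_iff finite_lessThan finite_subset)
  have entry: "sym_unit_mat ?n (Min d) (Max d) $$ (i, j) = (if d = {i, j} then 1 else 0)"
    if "d \<in> edge_index G" for d
  proof -
    have "d \<in> all_pairs ?n" using that sub by blast
    then obtain a b where "d = {a, b}" "a < ?n" "b < ?n" "a \<noteq> b"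
      unfolding all_pairs_def by blast
    then obtain a b where ab: "d = {a, b}" "a < ?n" "b < ?n" "a < b"
      by (metis insert_commute linorder_neqE_nat)
    then have "Min d = a" "Max d = b" by auto
    then show ?thesis
      using ab ij by (auto simp: sym_unit_mat_def outer_prod_def doubleton_eq_iff)
  qed
  have "edge_mat G y $$ (i, j) = (\<Sum>d\<in>edge_index G. y d * (if d = {i, j} then 1 else 0))"
    using ij entry by (simp add: edge_mat_def)
  also have "\<dots> = (\<Sum>d\<in>edge_index G. if d = {i, j} then y d else 0)"
    by (intro sum.cong) auto
  finally show ?thesis
    using fin by simp
qed

text \<open>The transposed configuration matrix contributes the \<open>r\<close> coordinate
  equations and the appended row of ones the condition of sum 0. From here on the kernel is handled
  as the set of affine dependencies.\<close>

lemma kernel_index: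
  fixes p :: "nat \<Rightarrow> real vec"
  assumes "\<forall>i<n. p i \<in> carrier_vec r"
  defines "M \<equiv> transpose_mat (config_mat r n p) @\<^sub>r mat_of_rows n [ones_vec n]"
  shows "M \<in> carrier_mat (r + 1) n"
    and "z \<in> mat_kernel M \<longleftrightarrow>
      z \<in> carrier_vec n \<and> (\<Sum>i<n. z $ i) = 0 \<and> (\<forall>k<r. (\<Sum>i<n. z $ i * p i $ k) = 0)"
proof -
  let ?P = "transpose_mat (config_mat r n p)" and ?e = "mat_of_rows n [ones_vec n]"
  have P: "?P \<in> carrier_mat r n" and e: "?e \<in> carrier_mat 1 n"
    by (auto simp: config_mat_def)
  show M: "M \<in> carrier_mat (r + 1) n"
    unfolding M_def using carrier_append_rows[OF P e] .
  have eq0: "?P *\<^sub>v z @\<^sub>v ?e *\<^sub>v z = 0\<^sub>v (r + 1) \<longleftrightarrow>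
      (\<Sum>i<n. z $ i) = 0 \<and> (\<forall>k<r. (\<Sum>i<n. z $ i * p i $ k) = 0)" if z: "z \<in> carrier_vec n"
  proof -
    have "(?P *\<^sub>v z) $ k = (\<Sum>i<n. z $ i * p i $ k)" if "k < r" for k
      using that z by (auto simp: config_mat_def scalar_prod_def mat_of_rows_def atLeast0LessThan intro!: sum.cong)
    moreover have "(?e *\<^sub>v z) $ 0 = (\<Sum>i<n. z $ i)"
      using z by (auto simp: ones_vec_def scalar_prod_def mat_of_rows_def atLeast0LessThan intro!: sum.cong)
    ultimately show ?thesis
      using P e by (auto simp: vec_eq_iff less_Suc_eq all_conj_distrib config_mat_def)
  qed
  show "z \<in> mat_kernel M \<longleftrightarrow>
      z \<in> carrier_vec n \<and> (\<Sum>i<n. z $ i) = 0 \<and> (\<forall>k<r. (\<Sum>i<n. z $ i * p i $ k) = 0)"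
    unfolding mat_kernel[OF M] using eq0 mat_mult_append[OF P e] unfolding M_def by auto
qed

text \<open>Differences of points of the affine span are the combinations with weights of sum 0.
  They form a subspace, which full dimension makes all of R^r, so every unit vector is such a
  combination.\<close>

lemma dual_frame_of_full_dim:
  fixes p :: "nat \<Rightarrow> real vec"
  assumes p: "\<forall>i<n. p i \<in> carrier_vec r" and "n > 0"
    and dim: "affine_subspace_dim r (affine_span r n p) = r"
  obtains \<beta> :: "nat \<Rightarrow> nat \<Rightarrow> real"
  where "\<And>k. k < r \<Longrightarrow> (\<Sum>m<n. \<beta> k m) = 0"
    and "\<And>k l. k < r \<Longrightarrow> l < r \<Longrightarrow> (\<Sum>m<n. \<beta> k m * p m $ l) = (if k = l then 1 else 0)"
proof -
  interpret V: vec_space "TYPE(real)" r .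
  let ?X = "affine_span r n p"
  define L where "L c = vec r (\<lambda>k. \<Sum>i<n. c i * p i $ k)" for c :: "nat \<Rightarrow> real"
  define W where "W = {L c | c. (\<Sum>i<n. c i) = 0}"
  have "{x - y | x y. x \<in> ?X \<and> y \<in> ?X} = W"
  proof (intro equalityI subsetI)
    fix w assume "w \<in> {x - y | x y. x \<in> ?X \<and> y \<in> ?X}"
    then obtain c d where "w = L c - L d" "(\<Sum>i<n. c i) = 1" "(\<Sum>i<n. d i) = 1"
      unfolding affine_span_def L_def by blast
    moreover have "L c - L d = L (\<lambda>i. c i - d i)"
      by (auto simp: L_def left_diff_distrib sum_subtractf)
    ultimately show "w \<in> W"
      unfolding W_def by (auto simp: sum_subtractf)
  next
    fix w assume "w \<in> W"
    then obtain c where c: "w = L c" "(\<Sum>i<n. c i) = 0"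
      unfolding W_def by blast
    \<comment> \<open>All weight on vertex 0: adding \<open>d\<close> turns weights of sum 0 into
      weights of sum 1, and subtracting \<open>L d\<close> restores \<open>L c\<close>.\<close>
    define d where "d i = (if i = 0 then 1 else 0 :: real)" for i :: nat
    have d: "(\<Sum>i<n. d i) = 1"
      using \<open>n > 0\<close> by (simp add: d_def)
    have "L c = L (\<lambda>i. c i + d i) - L d"
      by (auto simp: L_def distrib_right sum.distrib)
    moreover have "L (\<lambda>i. c i + d i) \<in> ?X" "L d \<in> ?X"
      unfolding affine_span_def L_def using c d by (auto simp: sum.distrib)
    ultimately show "w \<in> {x - y | x y. x \<in> ?X \<and> y \<in> ?X}"
      using c by blast
  qed
  moreover have "subspace class_ring W V.V"
  proof (rule subspace.intro)
    show "vectorspace class_ring V.V" by (rule vec_vs)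
    show "submodule class_ring W V.V"
    proof (rule submodule.intro)
      show "module class_ring V.V" by (rule vec_module)
      show "W \<subseteq> carrier V.V" by (auto simp: W_def L_def)
      show "v \<oplus>\<^bsub>V.V\<^esub> w \<in> W" if vw: "v \<in> W" "w \<in> W" for v w
      proof -
        from vw obtain c d where "v = L c" "w = L d" "(\<Sum>i<n. c i) = 0" "(\<Sum>i<n. d i) = 0"
          unfolding W_def by blast
        moreover have "L c + L d = L (\<lambda>i. c i + d i)"
          by (auto simp: L_def distrib_right sum.distrib)
        ultimately show ?thesis
          unfolding W_def by (auto simp: sum.distrib)
      qed
      have "0\<^sub>v r = L (\<lambda>_. 0)" by (auto simp: L_def)
      then show "\<zero>\<^bsub>V.V\<^esub> \<in> W" unfolding W_def by auto
      show "a \<odot>\<^bsub>V.V\<^esub> v \<in> W" if v: "v \<in> W" for a v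
      proof -
        from v obtain c where "v = L c" "(\<Sum>i<n. c i) = 0"
          unfolding W_def by blast
        moreover have "a \<cdot>\<^sub>v L c = L (\<lambda>i. a * c i)"
          by (auto simp: L_def sum_distrib_left mult.assoc)
        ultimately show ?thesis
          unfolding W_def by (auto simp flip: sum_distrib_left)
      qed
    qed
  qed
  ultimately have W: "W = carrier_vec r"
    using V.subspace_full_dim[OF V.fin_dim] dim unfolding affine_subspace_dim_def V.dim_is_n by simp
  have "\<exists>c. (\<Sum>m<n. c m) = 0 \<and> (\<forall>l<r. (\<Sum>m<n. c m * p m $ l) = (if k = l then 1 else 0))"
    if k: "k < r" for k
  proof -
    have "unit_vec r k \<in> W" by (simp add: W)
    then obtain c where c: "unit_vec r k = L c" "(\<Sum>m<n. c m) = 0"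
      unfolding W_def by blast
    have "(\<Sum>m<n. c m * p m $ l) = (if k = l then 1 else 0)" if l: "l < r" for l
    proof -
      have "(\<Sum>m<n. c m * p m $ l) = L c $ l"
        using l by (simp add: L_def)
      also have "\<dots> = unit_vec r k $ l"
        by (simp only: c(1))
      finally show ?thesis
        using l k by (auto simp: unit_vec_def)
    qed
    with c(2) show ?thesis by blast
  qed
  then have "\<forall>k\<in>{..<r}. \<exists>c. (\<Sum>m<n. c m) = 0 \<and>
      (\<forall>l<r. (\<Sum>m<n. c m * p m $ l) = (if k = l then 1 else 0))"
    by blast
  from bchoice[OF this] obtain \<beta> where "\<forall>k\<in>{..<r}. (\<Sum>m<n. \<beta> k m) = 0 \<and>
      (\<forall>l<r. (\<Sum>m<n. \<beta> k m * p m $ l) = (if k = l then 1 else 0))"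
    by blast
  then show ?thesis
    by (intro that[of \<beta>]) auto
qed

lemma gale_columns:
  assumes "tensegrity_framework r G p" "gale_matrix r G p Z" "l < nverts G - r - 1"
  shows "(\<Sum>i<nverts G. Z $$ (i, l)) = 0"
    and "k < r \<Longrightarrow> (\<Sum>i<nverts G. Z $$ (i, l) * p i $ k) = 0"
proof -
  let ?n = "nverts G"
  let ?M = "transpose_mat (config_mat r ?n p) @\<^sub>r mat_of_rows ?n [ones_vec ?n]"
  have p: "\<forall>i<?n. p i \<in> carrier_vec r"
    using assms(1) by (simp add: tensegrity_framework_def)
  interpret K: kernel "r + 1" ?n ?M
    by unfold_locales (rule kernel_index(1)[OF p])
  have Z: "Z \<in> carrier_mat ?n (?n - r - 1)" and "K.basis (set (cols Z))"
    using assms(2) by (auto simp: gale_matrix_def Let_def)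
  then have "set (cols Z) \<subseteq> mat_kernel ?M"
    unfolding K.Ker.basis_def by blast
  moreover have "col Z l \<in> set (cols Z)"
    using Z assms(3) by (simp add: cols_def)
  ultimately have "col Z l \<in> mat_kernel ?M"
    by blast
  then have "(\<Sum>i<?n. col Z l $ i) = 0" "\<forall>k<r. (\<Sum>i<?n. col Z l $ i * p i $ k) = 0"
    using kernel_index(2)[OF p] by auto
  then show "(\<Sum>i<?n. Z $$ (i, l)) = 0" "k < r \<Longrightarrow> (\<Sum>i<?n. Z $$ (i, l) * p i $ k) = 0"
    using Z assms(3) by auto
qed

text \<open>The spanning half of the basis property; \<open>gale_columns\<close> is the membership
  half. The combination runs over a set of column vectors, as \<open>span\<close> does, rather than
  over column indices.\<close>

lemma affine_dependency_in_gale_span: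
  fixes z :: "nat \<Rightarrow> real"
  assumes "tensegrity_framework r G p" "gale_matrix r G p Z"
    and "(\<Sum>i<nverts G. z i) = 0"
    and "\<And>k. k < r \<Longrightarrow> (\<Sum>i<nverts G. z i * p i $ k) = 0"
  shows "\<exists>U a. U \<subseteq> set (cols Z) \<and> (\<forall>i<nverts G. z i = (\<Sum>u\<in>U. a u * u $ i))"
proof -
  let ?n = "nverts G"
  let ?M = "transpose_mat (config_mat r ?n p) @\<^sub>r mat_of_rows ?n [ones_vec ?n]"
  have p: "\<forall>i<?n. p i \<in> carrier_vec r"
    using assms(1) by (simp add: tensegrity_framework_def)
  interpret K: kernel "r + 1" ?n ?M
    by unfold_locales (rule kernel_index(1)[OF p])
  have "K.basis (set (cols Z))"
    using assms(2) by (auto simp: gale_matrix_def Let_def)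
  then have gen: "K.span (set (cols Z)) = mat_kernel ?M" and sub: "set (cols Z) \<subseteq> mat_kernel ?M"
    unfolding K.Ker.basis_def by auto
  have "vec ?n z \<in> mat_kernel ?M"
    using assms(3,4) kernel_index(2)[OF p] by simp
  then have "vec ?n z \<in> K.span (set (cols Z))"
    by (simp only: gen)
  then obtain a U where U: "U \<subseteq> set (cols Z)" and zU: "vec ?n z = K.lincomb a U"
    unfolding K.Ker.span_def by blast
  have "z i = (\<Sum>u\<in>U. a u * u $ i)" if "i < ?n" for i
  proof -
    have "z i = K.lincomb a U $ i"
      unfolding zU[symmetric] using that by simp
    also have "\<dots> = (\<Sum>u\<in>U. a u * u $ i)"
      using K.lincomb_index[OF that] U sub by blast
    finally show ?thesis .
  qed
  with U show ?thesis by blast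
qed

section \<open>Squared distances under affine and linear maps\<close>

lemma sq_dist_eq_sum:
  assumes "x \<in> carrier_vec r" "y \<in> carrier_vec r"
  shows "sq_dist x y = (\<Sum>k<r. (x $ k - y $ k)\<^sup>2)"
  using assms by (simp add: sq_dist_def scalar_prod_def atLeast0LessThan power2_eq_square)

text \<open>In the expansion of the squared distance, the square of \<open>x\<close> is killed by
  the sum 0 and the mixed term by the dependency. The right side is free of \<open>x\<close>, which
  is what makes the rows of the stress equation equal.\<close>

lemma dependency_sq_dist:
  fixes q :: "nat \<Rightarrow> real vec"
  assumes "\<forall>j<n. q j \<in> carrier_vec r" and x: "x \<in> carrier_vec r"
    and "(\<Sum>j<n. z j) = 0" and "\<And>k. k < r \<Longrightarrow> (\<Sum>j<n. z j * q j $ k) = 0"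
  shows "(\<Sum>j<n. z j * sq_dist x (q j)) = (\<Sum>j<n. z j * (\<Sum>k<r. (q j $ k)\<^sup>2))"
proof -
  have "(\<Sum>j<n. z j * sq_dist x (q j)) =
      (\<Sum>j<n. \<Sum>k<r. z j * (x $ k)\<^sup>2 - 2 * x $ k * (z j * q j $ k) + z j * (q j $ k)\<^sup>2)"
    using assms(1) x
    by (intro sum.cong refl)
       (simp add: sq_dist_eq_sum sum_distrib_left power2_diff algebra_simps)
  also have "\<dots> = (\<Sum>k<r. (\<Sum>j<n. z j) * (x $ k)\<^sup>2) - (\<Sum>k<r. 2 * x $ k * (\<Sum>j<n. z j * q j $ k))
      + (\<Sum>j<n. \<Sum>k<r. z j * (q j $ k)\<^sup>2)"
    by (simp add: sum.distrib sum_subtractf sum_distrib_left sum_distrib_right sum.swap[of _ "{..<n}" "{..<r}"])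
  finally show ?thesis
    using assms(3,4) by (simp add: sum_distrib_left)
qed

lemma affine_image_dependency:
  fixes p q :: "nat \<Rightarrow> real vec"
  assumes p: "\<forall>i<n. p i \<in> carrier_vec r"
    and A: "A \<in> carrier_mat r r" and b: "b \<in> carrier_vec r"
    and q: "\<forall>i<n. q i = A *\<^sub>v p i + b"
    and z: "(\<Sum>i<n. z i) = 0" "\<And>k. k < r \<Longrightarrow> (\<Sum>i<n. z i * p i $ k) = 0" and k: "k < r"
  shows "(\<Sum>i<n. z i * q i $ k) = 0"
proof -
  have q_index: "q i $ k = (\<Sum>l<r. A $$ (k, l) * p i $ l) + b $ k" if "i < n" for i
    using p[rule_format, OF that] that A b q k by (auto simp: scalar_prod_def atLeast0LessThan)
  have "(\<Sum>i<n. z i * q i $ k) = (\<Sum>i<n. (\<Sum>l<r. A $$ (k, l) * (z i * p i $ l)) + z i * b $ k)"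
    by (intro sum.cong refl) (simp add: q_index sum_distrib_left algebra_simps)
  also have "\<dots> = (\<Sum>l<r. A $$ (k, l) * (\<Sum>i<n. z i * p i $ l)) + (\<Sum>i<n. z i) * b $ k"
    by (simp add: sum.distrib sum_distrib_left sum_distrib_right sum.swap[of _ "{..<n}" "{..<r}"])
  finally show ?thesis using z by simp
qed

text \<open>With \<open>I + \<epsilon> T\<close> factored as the transpose of \<open>A\<close> times
  \<open>A\<close>, the squared length of \<open>A d\<close> is the form of
  \<open>I + \<epsilon> T\<close> at \<open>d\<close>, here for \<open>d = x - y\<close>.\<close>

lemma linear_map_of_quadratic_form:
  fixes T :: "nat \<Rightarrow> nat \<Rightarrow> real"
  assumes "\<And>k l. T k l = T l k"
  shows "\<exists>A \<in> carrier_mat r r. \<exists>\<epsilon>>0. \<forall>x \<in> carrier_vec r. \<forall>y \<in> carrier_vec r.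
      sq_dist (A *\<^sub>v x) (A *\<^sub>v y) =
      sq_dist x y + \<epsilon> * (\<Sum>k<r. \<Sum>l<r. T k l * (x $ k - y $ k) * (x $ l - y $ l))"
proof -
  \<comment> \<open>\<open>C\<close> bounds every entry of \<open>T\<close>, so
    \<open>\<epsilon>\<close> scales them all into the radius of \<open>gram_near_identity\<close>;
    the 1 added to \<open>C\<close> keeps the denominator positive when \<open>T\<close>
    vanishes.\<close>
  define C where "C = (\<Sum>k<r. \<Sum>l<r. \<bar>T k l\<bar>)"
  define \<epsilon> where "\<epsilon> = 1 / (2 * 3 ^ r * (C + 1))"
  define M where "M k l = (if k = l then 1 else 0) + \<epsilon> * T k l" for k l
  have "C \<ge> 0" unfolding C_def by (intro sum_nonneg) auto
  then have \<epsilon>: "\<epsilon> > 0" unfolding \<epsilon>_def by simp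
  have "\<exists>B. \<forall>k<r. \<forall>l<r. M k l = (\<Sum>m<r. B m k * B m l)"
  proof (rule gram_near_identity)
    show "M k l = M l k" for k l
      using assms[of k l] by (simp add: M_def)
    fix k l assume kl: "k < r" "l < r"
    have "\<bar>T k l\<bar> \<le> (\<Sum>l<r. \<bar>T k l\<bar>)"
      using kl by (intro member_le_sum) auto
    also have "\<dots> \<le> C"
      unfolding C_def using kl by (intro member_le_sum) (auto intro: sum_nonneg)
    finally have "\<epsilon> * \<bar>T k l\<bar> \<le> \<epsilon> * (C + 1)"
      using \<epsilon> by (intro mult_left_mono) auto
    also have "\<dots> = 1 / (2 * 3 ^ r)"
      using \<open>C \<ge> 0\<close> by (simp add: \<epsilon>_def)
    finally show "\<bar>M k l - (if k = l then 1 else 0)\<bar> \<le> 1 / (2 * 3 ^ r)"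
      using \<epsilon> by (simp add: M_def abs_mult)
  qed
  then obtain B where B: "\<And>k l. k < r \<Longrightarrow> l < r \<Longrightarrow> M k l = (\<Sum>m<r. B m k * B m l)"
    by blast
  define A where "A = mat r r (\<lambda>(k, l). B k l)"
  have A: "A \<in> carrier_mat r r" by (simp add: A_def)
  have "sq_dist (A *\<^sub>v x) (A *\<^sub>v y) =
      sq_dist x y + \<epsilon> * (\<Sum>k<r. \<Sum>l<r. T k l * (x $ k - y $ k) * (x $ l - y $ l))"
    if xy: "x \<in> carrier_vec r" "y \<in> carrier_vec r" for x y
  proof -
    define d where "d k = x $ k - y $ k" for k
    have Ad: "(A *\<^sub>v x) $ m - (A *\<^sub>v y) $ m = (\<Sum>k<r. B m k * d k)" if "m < r" for m
      using that xy
      by (simp add: A_def d_def scalar_prod_def atLeast0LessThan right_diff_distrib sum_subtractf)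
    have "sq_dist (A *\<^sub>v x) (A *\<^sub>v y) = (\<Sum>m<r. (\<Sum>k<r. B m k * d k)\<^sup>2)"
      using Ad mult_mat_vec_carrier[OF A] xy by (simp add: sq_dist_eq_sum[of _ r])
    also have "\<dots> = (\<Sum>m<r. \<Sum>k<r. \<Sum>l<r. B m k * B m l * (d k * d l))"
      by (simp add: power2_eq_square sum_product algebra_simps)
    \<comment> \<open>The sum over \<open>m\<close> is moved innermost, where it becomes the Gram
      entry \<open>M k l\<close>.\<close>
    also have "\<dots> = (\<Sum>k<r. \<Sum>m<r. \<Sum>l<r. B m k * B m l * (d k * d l))"
      by (rule sum.swap)
    also have "\<dots> = (\<Sum>k<r. \<Sum>l<r. M k l * (d k * d l))"
    proof (rule sum.cong)
      fix k assume k: "k \<in> {..<r}"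
      have "(\<Sum>m<r. \<Sum>l<r. B m k * B m l * (d k * d l)) = (\<Sum>l<r. \<Sum>m<r. B m k * B m l * (d k * d l))"
        by (rule sum.swap)
      also have "\<dots> = (\<Sum>l<r. M k l * (d k * d l))"
        using k by (intro sum.cong) (auto simp: B sum_distrib_right)
      finally show "(\<Sum>m<r. \<Sum>l<r. B m k * B m l * (d k * d l)) = (\<Sum>l<r. M k l * (d k * d l))" .
    qed simp
    also have "\<dots> = (\<Sum>k<r. (d k)\<^sup>2 + \<epsilon> * (\<Sum>l<r. T k l * d k * d l))"
    proof (rule sum.cong)
      fix k assume k: "k \<in> {..<r}"
      have "(\<Sum>l<r. M k l * (d k * d l)) =
          (\<Sum>l<r. (if l = k then (d k)\<^sup>2 else 0) + \<epsilon> * (T k l * d k * d l))"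
        by (intro sum.cong) (auto simp: M_def power2_eq_square algebra_simps)
      also have "\<dots> = (d k)\<^sup>2 + \<epsilon> * (\<Sum>l<r. T k l * d k * d l)"
        using k by (simp add: sum.distrib sum_distrib_left)
      finally show "(\<Sum>l<r. M k l * (d k * d l)) = (d k)\<^sup>2 + \<epsilon> * (\<Sum>l<r. T k l * d k * d l)" .
    qed simp
    also have "\<dots> = sq_dist x y + \<epsilon> * (\<Sum>k<r. \<Sum>l<r. T k l * d k * d l)"
      using xy by (simp add: sq_dist_eq_sum d_def sum.distrib sum_distrib_left)
    finally show ?thesis
      by (simp add: d_def)
  qed
  with A \<epsilon> show ?thesis by blast
qed

section \<open>From dominated frameworks to stresses and back\<close>

lemma edge_mat_mult_index:
  assumes "Z \<in> carrier_mat (nverts G) m" "i < nverts G" "l < m"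
  shows "(edge_mat G y * Z) $$ (i, l) = (\<Sum>j<nverts G. edge_mat G y $$ (i, j) * Z $$ (j, l))"
  using assms by (simp add: edge_mat_def scalar_prod_def atLeast0LessThan)

text \<open>The indices of \<open>y\<close> are exactly the pairs that are not bars, so a symmetric
  matrix has the form E(y) once it vanishes on the diagonal and on bars.\<close>

lemma pair_cases:
  assumes "is_tensegrity_graph G" "i < nverts G" "j < nverts G" "i \<noteq> j"
  shows "{i, j} \<in> bars G \<or> {i, j} \<in> edge_index G"
  using assms unfolding edge_index_def missing_edges_def edges_def all_pairs_def by blast

lemma edge_bounds:
  assumes "is_tensegrity_graph G" "{i, j} \<in> edges G \<union> edge_index G"
  shows "i < nverts G" "j < nverts G" "i \<noteq> j"
proof -
  have "{i, j} \<in> all_pairs (nverts G)"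
    using assms unfolding is_tensegrity_graph_def edge_index_def missing_edges_def edges_def by blast
  then show "i < nverts G" "j < nverts G" "i \<noteq> j"
    by (auto simp: all_pairs_def doubleton_eq_iff)
qed

lemma bars_disjoint_edge_index:
  assumes "is_tensegrity_graph G"
  shows "bars G \<inter> edge_index G = {}"
  using assms unfolding is_tensegrity_graph_def edge_index_def missing_edges_def edges_def by blast

lemma stress_of_affinely_dominated:
  assumes fw: "tensegrity_framework r G p" and gale: "gale_matrix r G p Z"
    and dom: "affinely_dominated r G q p" and ncong: "\<not> fw_congruent G q p"
  shows "\<exists>(y :: nat set \<Rightarrow> real) (\<xi> :: real vec).
       (\<exists>d \<in> edge_index G. y d \<noteq> 0) \<and>
       \<xi> \<in> carrier_vec (nverts G - r - 1) \<and>
       (\<forall>d \<in> cables G. y d \<ge> 0) \<and>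
       (\<forall>d \<in> struts G. y d \<le> 0) \<and>
       edge_mat G y * Z = outer_prod (ones_vec (nverts G)) \<xi>"
proof -
  let ?n = "nverts G"
  have graph: "is_tensegrity_graph G" and p: "\<forall>i<?n. p i \<in> carrier_vec r"
    using fw by (auto simp: tensegrity_framework_def)
  from dom obtain A b where A: "A \<in> carrier_mat r r" and b: "b \<in> carrier_vec r"
    and qA: "\<forall>i<?n. q i = A *\<^sub>v p i + b" and dom': "dominated G q p"
    unfolding affinely_dominated_def by blast
  have q: "\<forall>i<?n. q i \<in> carrier_vec r"
    using qA A b p by auto
  have Z: "Z \<in> carrier_mat ?n (?n - r - 1)"
    using gale by (simp add: gale_matrix_def Let_def)
  \<comment> \<open>Original minus image: this order makes cables nonnegative and struts
    nonpositive.\<close>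
  define Y where "Y i j = sq_dist (p i) (p j) - sq_dist (q i) (q j)" for i j
  define y where "y d = Y (Min d) (Max d)" for d
  \<comment> \<open>The difference of the two values that \<open>dependency_sq_dist\<close> yields
    for column \<open>l\<close>, once with \<open>p\<close> and once with \<open>q\<close>.\<close>
  define \<xi> where "\<xi> = vec (?n - r - 1)
    (\<lambda>l. \<Sum>j<?n. Z $$ (j, l) * ((\<Sum>k<r. (p j $ k)\<^sup>2) - (\<Sum>k<r. (q j $ k)\<^sup>2)))"
  have Y_sym: "Y i j = Y j i" if "i < ?n" "j < ?n" for i j
    using that p q by (simp add: Y_def sq_dist_eq_sum[of _ r] power2_commute)
  have y: "y {i, j} = Y i j" if "i < ?n" "j < ?n" for i j
    using Y_sym[OF that] by (cases "i \<le> j") (auto simp: y_def min_def max_def)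
  have Y_bar: "Y i j = 0" if "{i, j} \<in> bars G" for i j
    using dom' that by (simp add: Y_def dominated_def)
  have mat_Y: "edge_mat G y $$ (i, j) = Y i j" if ij: "i < ?n" "j < ?n" for i j
  proof (cases "i = j")
    case True
    then have "{i, j} \<notin> edge_index G"
      using edge_bounds(3)[OF graph, of i j] by blast
    moreover have "Y i j = 0"
      using True p q ij by (simp add: Y_def sq_dist_eq_sum[of _ r])
    ultimately show ?thesis
      using edge_mat_index[OF graph ij] by simp
  next
    case False
    then show ?thesis
      using pair_cases[OF graph ij] Y_bar y[OF ij] edge_mat_index[OF graph ij, of y] by auto
  qed
  have "\<exists>d\<in>edge_index G. y d \<noteq> 0"
  proof -
    from ncong obtain i j where ij: "i < ?n" "j < ?n" and "Y i j \<noteq> 0"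
      unfolding fw_congruent_def Y_def by auto
    \<comment> \<open>A nonzero entry of E(y) can only come from a pair in
      \<open>edge_index\<close>, which also excludes \<open>i = j\<close>.\<close>
    then have "(if {i, j} \<in> edge_index G then y {i, j} else 0) \<noteq> 0"
      using mat_Y[OF ij] edge_mat_index[OF graph ij, of y] by simp
    then show ?thesis
      by (cases "{i, j} \<in> edge_index G") auto
  qed
  moreover have "\<forall>d\<in>cables G. y d \<ge> 0" and "\<forall>d\<in>struts G. y d \<le> 0"
  proof -
    have "\<exists>i j. d = {i, j} \<and> i < ?n \<and> j < ?n" if "d \<in> cables G \<union> struts G" for d
      using that graph unfolding is_tensegrity_graph_def edges_def all_pairs_def by blast
    moreover have "Y i j \<ge> 0" if "{i, j} \<in> cables G" for i j
      using dom' that by (simp add: Y_def dominated_def)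
    moreover have "Y i j \<le> 0" if "{i, j} \<in> struts G" for i j
      using dom' that by (simp add: Y_def dominated_def)
    ultimately show "\<forall>d\<in>cables G. y d \<ge> 0" "\<forall>d\<in>struts G. y d \<le> 0"
      using y by (metis UnI1, metis UnI2)
  qed
  moreover have "edge_mat G y * Z = outer_prod (ones_vec ?n) \<xi>"
  proof (rule eq_matI)
    fix i l assume "i < dim_row (outer_prod (ones_vec ?n) \<xi>)" "l < dim_col (outer_prod (ones_vec ?n) \<xi>)"
    then have il: "i < ?n" "l < ?n - r - 1"
      by (auto simp: outer_prod_def ones_vec_def \<xi>_def)
    note dep = gale_columns[OF fw gale il(2)]
    have "(edge_mat G y * Z) $$ (i, l) = (\<Sum>j<?n. Z $$ (j, l) * Y i j)"
      using edge_mat_mult_index[OF Z il] mat_Y il by (simp add: mult.commute)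
    also have "\<dots> = (\<Sum>j<?n. Z $$ (j, l) * sq_dist (p i) (p j)) - (\<Sum>j<?n. Z $$ (j, l) * sq_dist (q i) (q j))"
      by (simp add: Y_def right_diff_distrib sum_subtractf)
    also have "\<dots> = \<xi> $ l"
      using dependency_sq_dist[OF p _ dep, of "p i"]
        dependency_sq_dist[OF q _ dep(1) affine_image_dependency[OF p A b qA dep], of "q i"] p q il
      by (simp add: \<xi>_def right_diff_distrib sum_subtractf)
    finally show "(edge_mat G y * Z) $$ (i, l) = outer_prod (ones_vec ?n) \<xi> $$ (i, l)"
      using il by (simp add: outer_prod_def ones_vec_def \<xi>_def)
  qed (use Z in \<open>auto simp: outer_prod_def ones_vec_def \<xi>_def edge_mat_def\<close>)
  moreover have "\<xi> \<in> carrier_vec (?n - r - 1)" by (simp add: \<xi>_def)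
  ultimately show ?thesis by blast
qed

text \<open>The constructed map changes each squared distance by
  \<open>-2 * \<epsilon> * Y i j\<close>. Bars keep their length since \<open>Y\<close> vanishes
  there, the signs of \<open>y\<close> settle cables and struts, and a nonzero \<open>y d\<close>
  rules out congruence.\<close>

lemma affinely_dominated_of_stress:
  assumes fw: "tensegrity_framework r G p" and dim: "framework_dim r G p = r"
    and gale: "gale_matrix r G p Z"
    and nonzero: "\<exists>d \<in> edge_index G. y d \<noteq> 0"
    and \<xi>: "\<xi> \<in> carrier_vec (nverts G - r - 1)"
    and cables: "\<forall>d \<in> cables G. y d \<ge> 0" and struts: "\<forall>d \<in> struts G. y d \<le> 0"
    and stress: "edge_mat G y * Z = outer_prod (ones_vec (nverts G)) \<xi>"
  shows "\<exists>q. tensegrity_framework r G q \<and> affinely_dominated r G q p \<and> \<not> fw_congruent G q p"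
proof -
  let ?n = "nverts G"
  have graph: "is_tensegrity_graph G" and p: "\<forall>i<?n. p i \<in> carrier_vec r"
    using fw by (auto simp: tensegrity_framework_def)
  have n: "?n > 0"
    using graph by (simp add: is_tensegrity_graph_def graph_connected_def)
  have Z: "Z \<in> carrier_mat ?n (?n - r - 1)"
    using gale by (simp add: gale_matrix_def Let_def)
  obtain \<beta> :: "nat \<Rightarrow> nat \<Rightarrow> real" where
    \<beta>: "\<And>k. k < r \<Longrightarrow> (\<Sum>m<?n. \<beta> k m) = 0"
      "\<And>k l. k < r \<Longrightarrow> l < r \<Longrightarrow> (\<Sum>m<?n. \<beta> k m * p m $ l) = (if k = l then 1 else 0)"
    using dual_frame_of_full_dim[OF p n] dim unfolding framework_dim_def by blast
  define Y where "Y i j = (if {i, j} \<in> edge_index G then y {i, j} else 0)" for i j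
  have mat_Y: "edge_mat G y $$ (i, j) = Y i j" if "i < ?n" "j < ?n" for i j
    using edge_mat_index[OF graph that] by (simp add: Y_def)
  have const: "\<exists>c. \<forall>i<?n. (\<Sum>m<?n. Y i m * z m) = c"
    if z: "(\<Sum>m<?n. z m) = 0" "\<And>l. l < r \<Longrightarrow> (\<Sum>m<?n. z m * p m $ l) = 0" for z
  proof -
    have "\<exists>U a. U \<subseteq> set (cols Z) \<and> (\<forall>m<?n. z m = (\<Sum>u\<in>U. a u * u $ m))"
      by (rule affine_dependency_in_gale_span[OF fw gale z])
    then obtain U a where U: "U \<subseteq> set (cols Z)"
      and zU: "\<And>m. m < ?n \<Longrightarrow> z m = (\<Sum>u\<in>U. a u * u $ m)"
      by blast
    \<comment> \<open>Row 0 serves as the reference, so the common value can be written without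
      choosing a column index for each \<open>u\<close>.\<close>
    have col: "(\<Sum>m<?n. Y i m * u $ m) = (\<Sum>m<?n. Y 0 m * u $ m)" if i: "i < ?n" and u: "u \<in> U" for i u
    proof -
      obtain l where l: "l < ?n - r - 1" "u = col Z l"
        using u U Z by (auto simp: cols_def)
      have "(\<Sum>m<?n. Y i m * u $ m) = \<xi> $ l" if "i < ?n" for i
      proof -
        have "(\<Sum>m<?n. Y i m * u $ m) = (edge_mat G y * Z) $$ (i, l)"
          using edge_mat_mult_index[OF Z that l(1)] mat_Y that l Z by simp
        then show ?thesis
          using stress that l \<xi> by (simp add: outer_prod_def ones_vec_def)
      qed
      then show ?thesis using i n by simp
    qed
    have "(\<Sum>m<?n. Y i m * z m) = (\<Sum>u\<in>U. a u * (\<Sum>m<?n. Y i m * u $ m))" for i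
    proof -
      have "(\<Sum>m<?n. Y i m * z m) = (\<Sum>m<?n. \<Sum>u\<in>U. a u * (Y i m * u $ m))"
        by (intro sum.cong refl) (simp add: zU sum_distrib_left algebra_simps)
      then show ?thesis
        by (subst (asm) sum.swap) (simp add: sum_distrib_left)
    qed
    then have "\<forall>i<?n. (\<Sum>m<?n. Y i m * z m) = (\<Sum>u\<in>U. a u * (\<Sum>m<?n. Y 0 m * u $ m))"
      by (auto intro!: sum.cong arg_cong2[where f = "(*)"] col)
    then show ?thesis by blast
  qed
  have Y_sym: "Y i j = Y j i" for i j
    by (simp add: Y_def insert_commute)
  have Y_diag: "Y i i = 0" for i
    using edge_bounds(3)[OF graph, of i i] by (auto simp: Y_def)
  have "\<exists>T :: nat \<Rightarrow> nat \<Rightarrow> real. (\<forall>k l. T k l = T l k) \<and>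
    (\<forall>i<?n. \<forall>j<?n.
      Y i j = - (1 / 2) * (\<Sum>k<r. \<Sum>l<r. T k l * (p i $ k - p j $ k) * (p i $ l - p j $ l)))"
    by (rule zero_diagonal_matrix_quadratic_form[where p = "\<lambda>i k. p i $ k" and \<beta> = \<beta>, OF n Y_sym Y_diag \<beta> const])
  then obtain T :: "nat \<Rightarrow> nat \<Rightarrow> real" where T: "\<And>k l. T k l = T l k"
    and YT: "\<And>i j. i < ?n \<Longrightarrow> j < ?n \<Longrightarrow>
      Y i j = - (1 / 2) * (\<Sum>k<r. \<Sum>l<r. T k l * (p i $ k - p j $ k) * (p i $ l - p j $ l))"
    by blast
  from linear_map_of_quadratic_form[of T r, OF T]
  obtain A \<epsilon> where A: "A \<in> carrier_mat r r" and \<epsilon>: "\<epsilon> > 0"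
    and dist: "\<And>x y. x \<in> carrier_vec r \<Longrightarrow> y \<in> carrier_vec r \<Longrightarrow>
      sq_dist (A *\<^sub>v x) (A *\<^sub>v y) =
      sq_dist x y + \<epsilon> * (\<Sum>k<r. \<Sum>l<r. T k l * (x $ k - y $ k) * (x $ l - y $ l))"
    by blast
  define q where "q i = A *\<^sub>v p i" for i
  \<comment> \<open>The factor 2 undoes the -1/2 in \<open>YT\<close>.\<close>
  have q_dist: "sq_dist (q i) (q j) = sq_dist (p i) (p j) - 2 * \<epsilon> * Y i j" if "i < ?n" "j < ?n" for i j
    using dist[of "p i" "p j"] YT[OF that] p that by (simp add: q_def)
  have "tensegrity_framework r G q"
    using graph p A by (auto simp: tensegrity_framework_def q_def)
  moreover have "affinely_dominated r G q p"
  proof -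
    have "sq_dist (q i) (q j) = sq_dist (p i) (p j)" if "{i, j} \<in> bars G" for i j
      using that bars_disjoint_edge_index[OF graph] edge_bounds[OF graph, of i j] q_dist[of i j]
      by (auto simp: Y_def edges_def)
    moreover have "sq_dist (q i) (q j) \<le> sq_dist (p i) (p j)" if "{i, j} \<in> cables G" for i j
      using that cables edge_bounds[OF graph, of i j] q_dist[of i j] \<epsilon>
      by (auto simp: Y_def edges_def edge_index_def)
    moreover have "sq_dist (q i) (q j) \<ge> sq_dist (p i) (p j)" if "{i, j} \<in> struts G" for i j
      using that struts edge_bounds[OF graph, of i j] q_dist[of i j] \<epsilon>
      by (auto simp: Y_def edges_def edge_index_def mult_nonneg_nonpos)
    ultimately have "dominated G q p"
      by (simp add: dominated_def)
    moreover have "\<forall>i<?n. q i = A *\<^sub>v p i + 0\<^sub>v r"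
      using A p by (auto simp: q_def)
    ultimately show ?thesis
      using A unfolding affinely_dominated_def by (meson zero_carrier_vec)
  qed
  moreover have "\<not> fw_congruent G q p"
  proof -
    from nonzero obtain d where d: "d \<in> edge_index G" "y d \<noteq> 0" by blast
    then have "d \<in> all_pairs ?n"
      using graph unfolding is_tensegrity_graph_def edge_index_def missing_edges_def edges_def by blast
    then obtain i j where "d = {i, j}" "i < ?n" "j < ?n"
      unfolding all_pairs_def by blast
    then show ?thesis
      using d q_dist[of i j] \<epsilon> by (auto simp: fw_congruent_def Y_def)
  qed
  ultimately show ?thesis by blast
qed

theorem lemma5p2:
  fixes r :: nat and G :: tensegrity_graph and p :: "nat \<Rightarrow> real vec" and Z :: "real mat"
  assumes "tensegrity_framework r G p"
    and "framework_dim r G p = r"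
    and "gale_matrix r G p Z"
  shows "(\<exists>p'. tensegrity_framework r G p' \<and> affinely_dominated r G p' p \<and> \<not> fw_congruent G p' p) \<longleftrightarrow>
    (\<exists>(y :: nat set \<Rightarrow> real) (\<xi> :: real vec).
       (\<exists>d \<in> edge_index G. y d \<noteq> 0) \<and>
       \<xi> \<in> carrier_vec (nverts G - r - 1) \<and>
       (\<forall>d \<in> cables G. y d \<ge> 0) \<and>
       (\<forall>d \<in> struts G. y d \<le> 0) \<and>
       edge_mat G y * Z = outer_prod (ones_vec (nverts G)) \<xi>)"
proof
  assume "\<exists>p'. tensegrity_framework r G p' \<and> affinely_dominated r G p' p \<and> \<not> fw_congruent G p' p"
  then obtain p' where "affinely_dominated r G p' p" "\<not> fw_congruent G p' p"
    by blast
  then show "\<exists>(y :: nat set \<Rightarrow> real) (\<xi> :: real vec).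
       (\<exists>d \<in> edge_index G. y d \<noteq> 0) \<and>
       \<xi> \<in> carrier_vec (nverts G - r - 1) \<and>
       (\<forall>d \<in> cables G. y d \<ge> 0) \<and>
       (\<forall>d \<in> struts G. y d \<le> 0) \<and>
       edge_mat G y * Z = outer_prod (ones_vec (nverts G)) \<xi>"
    by (rule stress_of_affinely_dominated[OF assms(1,3)])
qed (elim exE conjE, rule affinely_dominated_of_stress[OF assms])

end
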